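(* Let $\mathcal C\subset\mathbb R^N$ and $F:\mathcal C\to\mathbb R$, and consider the problem $\min_{x\in\mathcal C}F(x)$. Let $\{x_k\}_{k\ge 0}$, $\{\Delta_k\}_{k\ge0}$ be generated by the error-aware trust-region algorithm (described in the context) from an arbitrary $x_0\in\mathcal C$ and $\Delta_0>0$, with approximation models $m_k:\mathcal C\to\mathbb R$ and trust-region constraints $\vartheta_k:\mathcal C\to\mathbb R_{\ge0}$. Suppose: (A1) (constraints) (1) $\mathcal C=\bigcap_{i=1}^m\{x\in\mathbb R^N: c_i(x)\ge0\}$ with each $c_i:\mathbb R^N\to\mathbb R$ twice continuously differentiable; (2) $\mathcal C$ is nonempty, closed and convex; (3) a first-order constraint qualification holds at every critical point of $\min_{x\in\mathcal C}F(x)$. (A2) (objective) (1) $F$ is twice continuously differentiable on $\mathcal C$; (2) $F$ is bounded from below on $\mathcal C$; (3) $\|\nabla^2F\|_2$ is bounded on $\mathcal C$. (A3) (model) For all $k\in\mathbb N$: (1) $m_k$ is twice continuously differentiable on $\mathcal C$; (2) $m_k(x_k)=F(x_k)$; (3) $\nabla m_k(x_k)=\nabla F(x_k)$; (4) there is $\beta>0$ independent of $k$ such that $\beta_k:=1+\max_{x\in\mathcal C}\|\nabla^2m_k(x)\|_2\le\beta$. (A4) (trust-region constraint) For all $k\in\mathbb N$: (1) $\vartheta_k$ is twice continuously differentiable on $\mathcal C$; (2) there is $\kappa_{\nabla\vartheta}>0$ independent of $k$ with $\max_{x\in\mathcal C}\|\nabla\vartheta_k(x)\|\le\kappa_{\nabla\vartheta}$;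 (3) $\vartheta_k(x_k)=0$; (4) there are $\zeta>0$ and $\nu>1$ independent of $k$ such that $|F(x)-m_k(x)|\le\zeta\,\vartheta_k(x)^\nu$ for all $x\in\mathcal B_k:=\{x\in\mathcal C:\vartheta_k(x)\le\Delta_k\}$. Then $$\liminf_{k\to\infty}\chi(x_k)=0,\qquad\text{where }\ \chi(x):=\Big|\min_{x+d\in\mathcal C,\ \|d\|_2\le1}\langle\nabla F(x),d\rangle\Big|.$$
   Context: $\|\cdot\|$ is the Euclidean norm on vectors, $\|\cdot\|_2$ the spectral norm on matrices. A first-order constraint qualification at $x\in\mathcal C$ means: the tangent cone of $\mathcal C$ at $x$ equals the cone of linearized feasible directions $\{d:\nabla c_i(x)^Td\ge0\text{ for all }i\text{ with }c_i(x)=0\}$. Error-aware trust-region algorithm. Given $x_0\in\mathcal C$, $0<\Delta_0\le\Delta_{\max}$, $0<\gamma_1<\gamma_2<1$, $0<\eta_1<\eta_2<1$, at each iteration $k=0,1,2,\dots$: 1. Choose a model $m_k$ and a trust-region constraint $\vartheta_k$; set $\mathcal B_k=\{x\in\mathcal C:\vartheta_k(x)\le\Delta_k\}$. 2. Compute a candidate $\hat x_k\in\mathcal B_k$ (an approximate solution of $\min_{x\in\mathcal B_k}m_k(x)$) satisfying the fraction of Cauchy decrease condition $$m_k(x_k)-m_k(\hat x_k)\ \ge\ \kappa\,\chi(x_k)\min\Big[\frac{\chi(x_k)}{\beta_k},\ \kappa'\Delta_k,\ 1\Big],$$ where $\kappa\in(0,1)$ and $\kappa'>0$ are constants independent of $k$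 and $\beta_k=1+\max_{x\in\mathcal C}\|\nabla^2m_k(x)\|_2$. 3. Compute $\varrho_k=\dfrac{F(x_k)-F(\hat x_k)}{m_k(x_k)-m_k(\hat x_k)}$. 4. If $\varrho_k\ge\eta_1$ set $x_{k+1}=\hat x_k$; otherwise set $x_{k+1}=x_k$. 5. If $\varrho_k<\eta_1$ choose $\Delta_{k+1}\in[\gamma_1\Delta_k,\gamma_2\Delta_k]$; if $\varrho_k\in[\eta_1,\eta_2)$ choose $\Delta_{k+1}\in[\gamma_2\Delta_k,\Delta_k]$; if $\varrho_k\ge\eta_2$ choose $\Delta_{k+1}\in[\Delta_k,\Delta_{\max}]$. *)

theory Defs
  imports "HOL-Analysis.Analysis"
begin

text \<open>
  Functions given on a closed set \<open>C\<close> are total functions here whose values off \<open>C\<close> matter only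
  near \<open>C\<close>: twice continuously differentiable on \<open>C\<close> means so on some open set containing \<open>C\<close>.
  Then gradient and Hessian on \<open>C\<close> are the ordinary two-sided ones, also at boundary points and
  when \<open>C\<close> has empty interior.
\<close>

definition gradient :: "(real^'n \<Rightarrow> real) \<Rightarrow> real^'n \<Rightarrow> real^'n" where
  "gradient f x = (THE g. GDERIV f x :> g)"

lemma gradient_eqI:
  assumes "GDERIV f x :> g"
  shows "gradient f x = g"
proof -
  have "g' = g" if "GDERIV f x :> g'" for g'
  proof -
    have "(\<lambda>h. h \<bullet> g') = (\<lambda>h. h \<bullet> g)"
      using that assms unfolding gderiv_def by (rule has_derivative_unique)
    then show ?thesis
      by (metis vector_eq_ldot)
  qed
  with assms show ?thesis
    unfolding gradient_def by blast
qed

definition hessian :: "(real^'n \<Rightarrow> real) \<Rightarrow> real^'n \<Rightarrow> real^'n^'n" where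
  "hessian f x = jacobian (gradient f) (at x)"

definition twice_cont_diff_on :: "(real^'n \<Rightarrow> real) \<Rightarrow> (real^'n) set \<Rightarrow> bool" where
  "twice_cont_diff_on f S \<longleftrightarrow>
     (\<exists>U. open U \<and> S \<subseteq> U \<and>
        (\<forall>x\<in>U. f differentiable (at x)) \<and>
        (\<forall>x\<in>U. gradient f differentiable (at x)) \<and>
        continuous_on U (hessian f))"

definition spectral_norm :: "real^'n^'n \<Rightarrow> real" where
  "spectral_norm A = onorm (\<lambda>v. A *v v)"

text \<open>The minimum is attained whenever \<open>C\<close> is closed and \<open>x \<in> C\<close>, since the feasible steps then
  form a nonempty compact set.\<close>

definition criticality :: "(real^'n) set \<Rightarrow> (real^'n \<Rightarrow> real) \<Rightarrow> real^'n \<Rightarrow> real" where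
  "criticality C F x = \<bar>INF d\<in>{d. x + d \<in> C \<and> norm d \<le> 1}. gradient F x \<bullet> d\<bar>"

definition tangent_cone :: "(real^'n) set \<Rightarrow> real^'n \<Rightarrow> (real^'n) set" where
  "tangent_cone C x =
     {d. \<exists>(z :: nat \<Rightarrow> real^'n) (t :: nat \<Rightarrow> real).
        (\<forall>n. z n \<in> C) \<and> z \<longlonglongrightarrow> x \<and> (\<forall>n. t n > 0) \<and> t \<longlonglongrightarrow> 0 \<and>
        (\<lambda>n. (z n - x) /\<^sub>R t n) \<longlonglongrightarrow> d}"

definition linearized_directions :: "nat \<Rightarrow> (nat \<Rightarrow> real^'n \<Rightarrow> real) \<Rightarrow> real^'n \<Rightarrow> (real^'n) set" where
  "linearized_directions p c x =
     {d. \<forall>i\<in>{1..p}. c i x = 0 \<longrightarrow> gradient (c i) x \<bullet> d \<ge> 0}"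

definition constraint_qualification ::
    "(real^'n) set \<Rightarrow> nat \<Rightarrow> (nat \<Rightarrow> real^'n \<Rightarrow> real) \<Rightarrow> real^'n \<Rightarrow> bool" where
  "constraint_qualification C p c x \<longleftrightarrow> tangent_cone C x = linearized_directions p c x"

text \<open>First-order critical point of minimising \<open>F\<close> over \<open>C\<close>: no feasible descent direction
  to first order. Multipliers do not enter; they exist at such points once a constraint
  qualification holds.\<close>

definition critical_point :: "(real^'n) set \<Rightarrow> (real^'n \<Rightarrow> real) \<Rightarrow> real^'n \<Rightarrow> bool" where
  "critical_point C F x \<longleftrightarrow> x \<in> C \<and> (\<forall>d\<in>tangent_cone C x. gradient F x \<bullet> d \<ge> 0)"

text \<open>The bound \<open>\<beta>\<^sub>k\<close> of a model. \<open>C\<close> may be unbounded, so the maximum is read as a supremum; it is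
  meaningful only together with \<open>bdd_above\<close> of the set of norms.\<close>

definition curvature_bound :: "(real^'n) set \<Rightarrow> (real^'n \<Rightarrow> real) \<Rightarrow> real" where
  "curvature_bound C q = 1 + (SUP x\<in>C. spectral_norm (hessian q x))"

definition trust_region :: "(real^'n) set \<Rightarrow> (real^'n \<Rightarrow> real) \<Rightarrow> real \<Rightarrow> (real^'n) set" where
  "trust_region C \<theta> \<Delta> = {x \<in> C. \<theta> x \<le> \<Delta>}"

text \<open>The ratio \<open>\<rho>\<close>. The denominator can vanish only at iterates with \<open>criticality C F (x k) = 0\<close>;
  there division by zero yields \<open>0\<close> and the candidate is rejected.\<close>

definition reduction_ratio :: "(real^'n \<Rightarrow> real) \<Rightarrow> (real^'n \<Rightarrow> real) \<Rightarrow> real^'n \<Rightarrow> real^'n \<Rightarrow> real" where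
  "reduction_ratio F q x y = (F x - F y) / (q x - q y)"

text \<open>The sequences of models \<open>m\<close>, trust-region constraints \<open>\<theta>\<close>, iterates \<open>x\<close>, candidates \<open>y\<close> and
  radii \<open>\<Delta>\<close> form a run of the algorithm; \<open>\<kappa>\<close> and \<open>\<kappa>'\<close> are the constants of the fraction of
  Cauchy decrease condition.\<close>

definition error_aware_trust_region_run ::
    "(real^'n) set \<Rightarrow> (real^'n \<Rightarrow> real) \<Rightarrow>
     real \<Rightarrow> real \<Rightarrow> real \<Rightarrow> real \<Rightarrow> real \<Rightarrow> real \<Rightarrow> real \<Rightarrow>
     (nat \<Rightarrow> real^'n \<Rightarrow> real) \<Rightarrow> (nat \<Rightarrow> real^'n \<Rightarrow> real) \<Rightarrow>
     (nat \<Rightarrow> real^'n) \<Rightarrow> (nat \<Rightarrow> real^'n) \<Rightarrow> (nat \<Rightarrow> real) \<Rightarrow> bool" where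
  "error_aware_trust_region_run C F \<Delta>max \<gamma>1 \<gamma>2 \<eta>1 \<eta>2 \<kappa> \<kappa>' m \<theta> x y \<Delta> \<longleftrightarrow>
     x 0 \<in> C \<and> 0 < \<Delta> 0 \<and> \<Delta> 0 \<le> \<Delta>max \<and>
     0 < \<gamma>1 \<and> \<gamma>1 < \<gamma>2 \<and> \<gamma>2 < 1 \<and>
     0 < \<eta>1 \<and> \<eta>1 < \<eta>2 \<and> \<eta>2 < 1 \<and>
     0 < \<kappa> \<and> \<kappa> < 1 \<and> 0 < \<kappa>' \<and>
     (\<forall>k.
        y k \<in> trust_region C (\<theta> k) (\<Delta> k) \<and>
        m k (x k) - m k (y k) \<ge>
          \<kappa> * criticality C F (x k) *
            Min {criticality C F (x k) / curvature_bound C (m k), \<kappa>' * \<Delta> k, 1} \<and>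
        (let \<rho> = reduction_ratio F (m k) (x k) (y k) in
           x (Suc k) = (if \<rho> \<ge> \<eta>1 then y k else x k) \<and>
           \<Delta> (Suc k) \<in>
             (if \<rho> < \<eta>1 then {\<gamma>1 * \<Delta> k..\<gamma>2 * \<Delta> k}
              else if \<rho> < \<eta>2 then {\<gamma>2 * \<Delta> k..\<Delta> k}
              else {\<Delta> k..\<Delta>max})))"

end

theory Submission
  imports Defs
begin

text \<open>
  Suppose the criticality measure stayed above some \<open>\<epsilon> > 0\<close> from some iteration on. Since the model
  curvatures are bounded, the Cauchy decrease condition then makes the predicted reduction at least
  \<open>\<kappa> * \<epsilon> * min b (\<kappa>' * \<Delta>)\<close> for a constant \<open>b > 0\<close>: it is of first order in the radius, whereas the
  model error is at most \<open>\<zeta> * \<Delta> powr \<nu>\<close> with \<open>\<nu> > 1\<close>. For small radii the error is therefore a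
  small fraction of the predicted reduction, the step is very successful
  (\<open>very_successful_if_small_error\<close>), and the radius does not shrink. A radius that
  shrinks at most by the factor \<open>\<gamma>\<^sub>1\<close> per iteration and only when it is not small stays away from zero
  (\<open>radius_bounded_away_from_zero\<close>).

  With the radius bounded away from zero, every accepted step lowers \<open>F\<close> by at least a fixed
  amount. As \<open>F\<close> never increases along the iterates and is bounded below, only finitely many steps
  are accepted (\<open>decreasing_bounded_below_imp_small_decrements\<close>). But then eventually all steps are
  rejected, so the radius shrinks geometrically to zero (\<open>geometric_decay_not_bounded_below\<close>), a
  contradiction.

  The algorithm measures the model error by \<open>\<theta>\<close>; it becomes an error in \<open>\<Delta>\<close> because the candidate
  satisfies \<open>\<theta> \<le> \<Delta>\<close>.
\<close>

section \<open>Real sequences\<close>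

text \<open>A drop below \<open>\<delta>\<close> can only come from a radius above \<open>\<delta>\<close>, so it loses at most one factor \<open>\<gamma>\<close>;
  below \<open>\<delta>\<close> the sequence no longer decreases.\<close>

lemma radius_bounded_away_from_zero:
  fixes \<Delta> :: "nat \<Rightarrow> real"
  assumes shrink: "\<And>k. k \<ge> K \<Longrightarrow> \<gamma> * \<Delta> k \<le> \<Delta> (Suc k)"
    and small: "\<And>k. k \<ge> K \<Longrightarrow> \<Delta> k \<le> \<delta> \<Longrightarrow> \<Delta> k \<le> \<Delta> (Suc k)"
    and \<gamma>: "0 < \<gamma>"
    and k: "k \<ge> K"
  shows "min (\<Delta> K) (\<gamma> * \<delta>) \<le> \<Delta> k"
  using k
proof (induction k rule: dec_induct)
  case base
  show ?case by simp
next
  case (step k)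
  show ?case
  proof (cases "\<Delta> k \<le> \<delta>")
    case True
    with small[of k] step show ?thesis by linarith
  next
    case False
    then have "\<gamma> * \<delta> \<le> \<gamma> * \<Delta> k"
      using \<gamma> by (intro mult_left_mono) auto
    with shrink[of k] step show ?thesis by linarith
  qed
qed

lemma decreasing_bounded_below_imp_small_decrements:
  fixes f :: "nat \<Rightarrow> real"
  assumes dec: "\<And>k. k \<ge> K \<Longrightarrow> f (Suc k) \<le> f k"
    and lower: "\<And>k. L \<le> f k"
    and "c > 0"
  shows "\<forall>\<^sub>F k in sequentially. f k - f (Suc k) < c"
proof -
  have "decseq (\<lambda>n. f (n + K))"
    by (rule decseq_SucI) (simp add: dec)
  then obtain l where "(\<lambda>n. f (n + K)) \<longlonglongrightarrow> l"
    by (rule decseq_convergent[where B = L]) (use lower in auto)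
  then have "f \<longlonglongrightarrow> l"
    by (rule LIMSEQ_offset)
  then have "(\<lambda>k. f k - f (Suc k)) \<longlonglongrightarrow> l - l"
    by (intro tendsto_diff LIMSEQ_Suc)
  then show ?thesis
    using \<open>c > 0\<close> by (auto intro: order_tendstoD(2))
qed

lemma geometric_decay_not_bounded_below:
  fixes \<Delta> :: "nat \<Rightarrow> real"
  assumes decay: "\<And>k. k \<ge> K \<Longrightarrow> \<Delta> (Suc k) \<le> \<gamma> * \<Delta> k"
    and \<gamma>: "0 \<le> \<gamma>" "\<gamma> < 1"
    and "\<delta> > 0"
  shows "\<exists>k\<ge>K. \<Delta> k < \<delta>"
proof -
  have bound: "\<Delta> (n + K) \<le> \<gamma> ^ n * \<Delta> K" for n
  proof (induction n)
    case (Suc n)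
    have "\<Delta> (Suc n + K) \<le> \<gamma> * \<Delta> (n + K)"
      using decay[of "n + K"] by simp
    also have "\<dots> \<le> \<gamma> * (\<gamma> ^ n * \<Delta> K)"
      using Suc \<gamma> by (intro mult_left_mono)
    finally show ?case by (simp add: mult.assoc)
  qed simp
  have "(\<lambda>n. \<gamma> ^ n * \<Delta> K) \<longlonglongrightarrow> 0 * \<Delta> K"
    using \<gamma> by (intro tendsto_mult tendsto_const LIMSEQ_realpow_zero)
  then have "\<forall>\<^sub>F n in sequentially. \<gamma> ^ n * \<Delta> K < \<delta>"
    using \<open>\<delta> > 0\<close> by (auto intro: order_tendstoD(2))
  then obtain n where "\<gamma> ^ n * \<Delta> K < \<delta>"
    by (auto simp: eventually_sequentially)
  with bound[of n] show ?thesis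
    by (intro exI[of _ "n + K"]) auto
qed

text \<open>An error of order \<open>\<nu> > 1\<close> is negligible against any linear function near zero: divide by the
  radius and solve for it.\<close>

lemma superlinear_le_linear_near_zero:
  fixes \<zeta> \<nu> a :: real
  assumes "\<zeta> > 0" "\<nu> > 1" "a > 0"
  shows "\<exists>\<delta>>0. \<forall>t. 0 < t \<and> t \<le> \<delta> \<longrightarrow> \<zeta> * t powr \<nu> \<le> a * t"
proof (intro exI conjI allI impI)
  let ?\<delta> = "(a / \<zeta>) powr (1 / (\<nu> - 1))"
  show "?\<delta> > 0" using assms by simp
  fix t assume t: "0 < t \<and> t \<le> ?\<delta>"
  have "t powr (\<nu> - 1) \<le> ?\<delta> powr (\<nu> - 1)"
    using t assms by (intro powr_mono2) auto
  also have "\<dots> = a / \<zeta>"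
    using assms by (simp add: powr_powr)
  finally have "\<zeta> * t powr (\<nu> - 1) \<le> a"
    using assms by (simp add: field_simps)
  then have "\<zeta> * t powr (\<nu> - 1) * t \<le> a * t"
    using t by (intro mult_right_mono) auto
  moreover have "t powr \<nu> = t powr (\<nu> - 1) * t"
    using t by (simp add: powr_diff)
  ultimately show "\<zeta> * t powr \<nu> \<le> a * t" by (simp add: mult.assoc)
qed

section \<open>One trust-region step\<close>

lemma criticality_nonneg: "criticality C F z \<ge> 0"
  by (simp add: criticality_def)

lemma curvature_bound_ge_1:
  assumes "C \<noteq> {}" and "bdd_above ((\<lambda>z. spectral_norm (hessian q z)) ` C)"
  shows "curvature_bound C q \<ge> 1"
proof -
  obtain z where z: "z \<in> C" using assms by blast
  have "0 \<le> spectral_norm (hessian q z)"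
    unfolding spectral_norm_def by (intro onorm_pos_le matrix_vector_mul_bounded_linear)
  also have "\<dots> \<le> (SUP z\<in>C. spectral_norm (hessian q z))"
    using assms z by (intro cSUP_upper)
  finally show ?thesis by (simp add: curvature_bound_def)
qed

text \<open>The actual reduction differs from the predicted one exactly by the model error at the
  candidate, because the model interpolates \<open>F\<close> at the iterate.\<close>

lemma very_successful_if_small_error:
  assumes "q x = F x" "q x - q y > 0"
    and "\<bar>F y - q y\<bar> \<le> (1 - \<eta>) * (q x - q y)"
  shows "reduction_ratio F q x y \<ge> \<eta>"
proof -
  have "\<eta> * (q x - q y) \<le> F x - F y"
    using assms by (simp add: algebra_simps abs_le_iff)
  then show ?thesis
    using assms(2) by (simp add: reduction_ratio_def pos_le_divide_eq)
qed

section \<open>Convergence\<close>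

theorem theorem7:
  fixes C :: "(real^'n) set" and F :: "real^'n \<Rightarrow> real"
    and p :: nat and c :: "nat \<Rightarrow> real^'n \<Rightarrow> real"
    and m \<theta> :: "nat \<Rightarrow> real^'n \<Rightarrow> real"
    and x y :: "nat \<Rightarrow> real^'n" and \<Delta> :: "nat \<Rightarrow> real"
    and \<Delta>max \<gamma>1 \<gamma>2 \<eta>1 \<eta>2 \<kappa> \<kappa>' :: real
  assumes run: "error_aware_trust_region_run C F \<Delta>max \<gamma>1 \<gamma>2 \<eta>1 \<eta>2 \<kappa> \<kappa>' m \<theta> x y \<Delta>"
    and A1_1: "C = (\<Inter>i\<in>{1..p}. {z. c i z \<ge> 0})" "\<forall>i\<in>{1..p}. twice_cont_diff_on (c i) UNIV"
    and A1_2: "C \<noteq> {}" "closed C" "convex C"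
    and A1_3: "\<forall>z. critical_point C F z \<longrightarrow> constraint_qualification C p c z"
    and A2_1: "twice_cont_diff_on F C"
    and A2_2: "bdd_below (F ` C)"
    and A2_3: "bdd_above ((\<lambda>z. spectral_norm (hessian F z)) ` C)"
    and A3_1: "\<forall>k. twice_cont_diff_on (m k) C"
    and A3_2: "\<forall>k. m k (x k) = F (x k)"
    and A3_3: "\<forall>k. gradient (m k) (x k) = gradient F (x k)"
    and A3_4: "\<exists>\<beta>>0. \<forall>k. bdd_above ((\<lambda>z. spectral_norm (hessian (m k) z)) ` C) \<and>
                        curvature_bound C (m k) \<le> \<beta>"
    and A4_0: "\<forall>k. \<forall>z\<in>C. \<theta> k z \<ge> 0"
    and A4_1: "\<forall>k. twice_cont_diff_on (\<theta> k) C"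
    and A4_2: "\<exists>\<kappa>\<theta>>0. \<forall>k. \<forall>z\<in>C. norm (gradient (\<theta> k) z) \<le> \<kappa>\<theta>"
    and A4_3: "\<forall>k. \<theta> k (x k) = 0"
    and A4_4: "\<exists>\<zeta>>0. \<exists>\<nu>>1. \<forall>k. \<forall>z\<in>trust_region C (\<theta> k) (\<Delta> k).
                 \<bar>F z - m k z\<bar> \<le> \<zeta> * \<theta> k z powr \<nu>"
  shows "liminf (\<lambda>k. ereal (criticality C F (x k))) = 0"
proof (rule ccontr)
  let ?\<chi> = "\<lambda>k. criticality C F (x k)"
  let ?\<rho> = "\<lambda>k. reduction_ratio F (m k) (x k) (y k)"
  let ?pred = "\<lambda>k. m k (x k) - m k (y k)"
  assume not0: "liminf (\<lambda>k. ereal (?\<chi> k)) \<noteq> 0"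
  have "0 \<le> liminf (\<lambda>k. ereal (?\<chi> k))"
    by (intro Liminf_bounded always_eventually) (simp add: criticality_nonneg)
  with not0 have "0 < liminf (\<lambda>k. ereal (?\<chi> k))" by simp
  then obtain \<epsilon> where \<epsilon>0: "0 < ereal \<epsilon>" and "ereal \<epsilon> < liminf (\<lambda>k. ereal (?\<chi> k))"
    using ereal_dense2 by blast
  then have "\<forall>\<^sub>F k in sequentially. ereal \<epsilon> < ereal (?\<chi> k)"
    by (intro less_LiminfD)
  then obtain K where \<chi>: "\<And>k. k \<ge> K \<Longrightarrow> \<epsilon> \<le> ?\<chi> k"
    by (auto simp: eventually_sequentially intro: less_imp_le)
  have \<epsilon>: "\<epsilon> > 0" using \<epsilon>0 by simp

  have params: "0 < \<Delta> 0" "0 < \<gamma>1" "\<gamma>1 < \<gamma>2" "\<gamma>2 < 1" "0 < \<eta>1" "\<eta>1 < \<eta>2" "\<eta>2 < 1" "0 < \<kappa>" "0 < \<kappa>'"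
    and x0: "x 0 \<in> C"
    and cand: "\<And>k. y k \<in> trust_region C (\<theta> k) (\<Delta> k)"
    and cauchy: "\<And>k. ?pred k \<ge> \<kappa> * ?\<chi> k * Min {?\<chi> k / curvature_bound C (m k), \<kappa>' * \<Delta> k, 1}"
    and iter: "\<And>k. x (Suc k) = (if ?\<rho> k \<ge> \<eta>1 then y k else x k)"
    and radius: "\<And>k. \<Delta> (Suc k) \<in> (if ?\<rho> k < \<eta>1 then {\<gamma>1 * \<Delta> k..\<gamma>2 * \<Delta> k}
              else if ?\<rho> k < \<eta>2 then {\<gamma>2 * \<Delta> k..\<Delta> k} else {\<Delta> k..\<Delta>max})"
    using run unfolding error_aware_trust_region_run_def Let_def by simp_all
  have xC: "x k \<in> C" for k
    by (induction k) (use x0 cand iter in \<open>simp_all add: trust_region_def\<close>)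
  have \<Delta>_shrink_pos: "\<gamma>1 * \<Delta> k \<le> \<Delta> (Suc k) \<and> 0 < \<Delta> k" for k
  proof -
    have shrink: "\<gamma>1 * \<Delta> k \<le> \<Delta> (Suc k)" if "0 < \<Delta> k" for k
    proof -
      have "\<gamma>1 * \<Delta> k \<le> \<gamma>2 * \<Delta> k" "\<gamma>1 * \<Delta> k \<le> 1 * \<Delta> k"
        using that params by (auto intro!: mult_right_mono)
      then show ?thesis
        using radius[of k] by (auto split: if_splits)
    qed
    have "0 < \<Delta> k"
    proof (induction k)
      case (Suc k)
      then have "0 < \<gamma>1 * \<Delta> k" using params by simp
      with shrink[OF Suc] show ?case by linarith
    qed (use params in simp)
    with shrink show ?thesis by blast
  qed
  note \<Delta>_shrink = conjunct1[OF \<Delta>_shrink_pos] and \<Delta>_pos = conjunct2[OF \<Delta>_shrink_pos]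

  obtain \<beta> where \<beta>: "\<beta> > 0"
      "\<And>k. bdd_above ((\<lambda>z. spectral_norm (hessian (m k) z)) ` C)"
      "\<And>k. curvature_bound C (m k) \<le> \<beta>"
    using A3_4 by meson
  \<comment> \<open>The part of the Cauchy decrease minimum that does not shrink with the radius.\<close>
  define b where "b = min (\<epsilon> / \<beta>) 1"
  have b: "b > 0" using \<epsilon> \<beta> by (simp add: b_def)
  have pred: "\<kappa> * \<epsilon> * min b (\<kappa>' * \<Delta> k) \<le> ?pred k" if "k \<ge> K" for k
  proof -
    let ?M = "Min {?\<chi> k / curvature_bound C (m k), \<kappa>' * \<Delta> k, 1}"
    have "\<epsilon> / \<beta> \<le> ?\<chi> k / curvature_bound C (m k)"
      using \<epsilon> \<chi>[OF that] \<beta>(3)[of k] curvature_bound_ge_1[OF A1_2(1) \<beta>(2)[of k]]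
      by (intro frac_le) auto
    then have "min b (\<kappa>' * \<Delta> k) \<le> ?M"
      by (auto simp: b_def)
    moreover have "0 \<le> min b (\<kappa>' * \<Delta> k)"
      using b params \<Delta>_pos[of k] by simp
    ultimately have "\<kappa> * \<epsilon> * min b (\<kappa>' * \<Delta> k) \<le> \<kappa> * ?\<chi> k * ?M"
      using \<chi>[OF that] params \<epsilon> by (intro mult_mono mult_nonneg_nonneg) auto
    with cauchy[of k] show ?thesis by linarith
  qed
  have pred_pos: "0 < ?pred k" if "k \<ge> K" for k
  proof -
    have "0 < \<kappa> * \<epsilon> * min b (\<kappa>' * \<Delta> k)"
      using params \<epsilon> b \<Delta>_pos[of k] by simp
    with pred[OF that] show ?thesis by linarith
  qed

  obtain \<zeta> \<nu> where \<zeta>: "\<zeta> > 0" and \<nu>: "\<nu> > 1"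
    and err: "\<And>k z. z \<in> trust_region C (\<theta> k) (\<Delta> k) \<Longrightarrow> \<bar>F z - m k z\<bar> \<le> \<zeta> * \<theta> k z powr \<nu>"
    using A4_4 by (elim exE conjE) simp
  have err_y: "\<bar>F (y k) - m k (y k)\<bar> \<le> \<zeta> * \<Delta> k powr \<nu>" for k
  proof -
    have "\<theta> k (y k) powr \<nu> \<le> \<Delta> k powr \<nu>"
      using cand[of k] A4_0 \<nu> by (intro powr_mono2) (auto simp: trust_region_def)
    then have "\<zeta> * \<theta> k (y k) powr \<nu> \<le> \<zeta> * \<Delta> k powr \<nu>"
      using \<zeta> by simp
    with err[OF cand[of k]] show ?thesis by linarith
  qed

  define a where "a = (1 - \<eta>2) * (\<kappa> * \<epsilon> * \<kappa>')"
  have "a > 0" using params \<epsilon> by (simp add: a_def)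
  then obtain \<delta>1 where \<delta>1: "\<delta>1 > 0" "\<And>t. 0 < t \<Longrightarrow> t \<le> \<delta>1 \<Longrightarrow> \<zeta> * t powr \<nu> \<le> a * t"
    using superlinear_le_linear_near_zero[OF \<zeta> \<nu>] by blast
  \<comment> \<open>Radii up to \<open>b / \<kappa>'\<close> are those for which the lower bound \<open>pred\<close> is linear in the radius.\<close>
  define \<delta>0 where "\<delta>0 = min \<delta>1 (b / \<kappa>')"
  have \<delta>0: "\<delta>0 > 0" using \<delta>1 b params by (simp add: \<delta>0_def)
  have small: "\<Delta> k \<le> \<Delta> (Suc k)" if k: "k \<ge> K" and le: "\<Delta> k \<le> \<delta>0" for k
  proof -
    have "\<kappa>' * \<Delta> k \<le> b"
      using le params by (simp add: \<delta>0_def pos_le_divide_eq mult.commute)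
    then have lin: "\<kappa> * \<epsilon> * (\<kappa>' * \<Delta> k) \<le> ?pred k"
      using pred[OF k] by (simp add: min_absorb2)
    have "\<bar>F (y k) - m k (y k)\<bar> \<le> \<zeta> * \<Delta> k powr \<nu>"
      by (rule err_y)
    also have "\<dots> \<le> a * \<Delta> k"
      using le \<Delta>_pos[of k] by (intro \<delta>1(2)) (auto simp: \<delta>0_def)
    also have "\<dots> = (1 - \<eta>2) * (\<kappa> * \<epsilon> * (\<kappa>' * \<Delta> k))"
      by (simp add: a_def)
    also have "\<dots> \<le> (1 - \<eta>2) * ?pred k"
      using lin params by (intro mult_left_mono) auto
    finally have "?\<rho> k \<ge> \<eta>2"
      using A3_2 pred_pos[OF k] by (intro very_successful_if_small_error) auto
    then show ?thesis
      using radius[of k] params by auto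
  qed
  define \<delta> where "\<delta> = min (\<Delta> K) (\<gamma>1 * \<delta>0)"
  have \<delta>: "\<delta> > 0" using \<delta>0 \<Delta>_pos params by (simp add: \<delta>_def)
  have \<Delta>_ge: "\<delta> \<le> \<Delta> k" if "k \<ge> K" for k
    unfolding \<delta>_def using \<Delta>_shrink small params(2) that by (rule radius_bounded_away_from_zero)

  define r where "r = \<eta>1 * (\<kappa> * \<epsilon> * min b (\<kappa>' * \<delta>))"
  have r: "r > 0" using params \<epsilon> b \<delta> by (simp add: r_def)
  have accepted: "r \<le> F (x k) - F (x (Suc k))" if k: "k \<ge> K" and acc: "?\<rho> k \<ge> \<eta>1" for k
  proof -
    have "\<kappa>' * \<delta> \<le> \<kappa>' * \<Delta> k"
      using \<Delta>_ge[OF k] params by simp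
    then have "\<kappa> * \<epsilon> * min b (\<kappa>' * \<delta>) \<le> \<kappa> * \<epsilon> * min b (\<kappa>' * \<Delta> k)"
      using params \<epsilon> by (intro mult_left_mono min.mono) auto
    also note pred[OF k]
    finally have "r \<le> \<eta>1 * ?pred k"
      unfolding r_def using params by (intro mult_left_mono) auto
    also have "\<dots> \<le> F (x k) - F (y k)"
      using acc pred_pos[OF k] by (simp add: reduction_ratio_def pos_le_divide_eq)
    finally show ?thesis using acc by (simp add: iter)
  qed
  have mono: "F (x (Suc k)) \<le> F (x k)" if "k \<ge> K" for k
    using accepted[OF that] r by (cases "?\<rho> k \<ge> \<eta>1") (auto simp: iter)
  obtain L where L: "\<And>z. z \<in> C \<Longrightarrow> L \<le> F z"
    using A2_2 unfolding bdd_below_def by blast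
  have "\<forall>\<^sub>F k in sequentially. F (x k) - F (x (Suc k)) < r"
    by (rule decreasing_bounded_below_imp_small_decrements[of K _ L])
      (use mono L xC r in auto)
  then obtain K' where K': "\<And>k. k \<ge> K' \<Longrightarrow> F (x k) - F (x (Suc k)) < r"
    by (auto simp: eventually_sequentially)
  have "\<Delta> (Suc k) \<le> \<gamma>2 * \<Delta> k" if "k \<ge> max K K'" for k
  proof -
    have "?\<rho> k < \<eta>1"
      using accepted[of k] K'[of k] that by (cases "?\<rho> k < \<eta>1") auto
    then show ?thesis using radius[of k] by simp
  qed
  then obtain k where "k \<ge> max K K'" "\<Delta> k < \<delta>"
    using geometric_decay_not_bounded_below[of "max K K'" \<Delta> \<gamma>2 \<delta>] params \<delta> by auto
  with \<Delta>_ge[of k] show False by simp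
qed

end
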